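(* Let $\Lambda$ be a $2$-dimensional lattice, $p$ a prime, $r>0$ an integer, $m=p^r$, and let $t$ be an integer with $0\le t\le \frac r2$. Then $$f_{(t,r-t)}(p)=\begin{cases}p^{r-2t}+p^{r-2t-1},&0\le t<\frac{r}{2},\\ 1,& t=\frac{r}{2}.\end{cases}$$ In particular, when $r$ is even, the unimodular equivalence class $\mathcal S_{\left(\frac r2,\frac r2\right)}(p)$ has only one sublattice.
   Context: A $2$-dimensional lattice is the $\mathbb{Z}$-span of $2$ linearly independent vectors in a Euclidean space; a sublattice of $\Lambda$ is a subset of $\Lambda$ which is itself a $2$-dimensional lattice. A coefficient matrix of a sublattice $\Lambda^*$ is the integer matrix whose rows are the coordinates, in a basis of $\Lambda$, of the vectors of a basis of $\Lambda^*$. The invariant factors of $\Lambda^*$ are the diagonal entries $d_1\mid d_2$ (positive integers) of the Smith normal form of a coefficient matrix; they do not depend on the choices of bases. Two sublattices $\Lambda^*,\Lambda^\bullet$ of $\Lambda$ are unimodular equivalent if there is a linear transformation $\sigma$ with $\sigma(\Lambda)=\Lambda$ and $\sigma(\Lambda^* )=\Lambda^\bullet$; this holds if and only if their invariant factors coincide. For integers $0\le a\le b$, $\mathcal S_{(a,b)}(p)$ is the unimodular equivalence class of all sublattices of $\Lambda$ with invariant factors $p^a,p^b$, and $f_{(a,b)}(p)$ is its cardinality. *)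

theory Defs
  imports "HOL-Analysis.Analysis" "HOL-Computational_Algebra.Primes"
begin

section \<open>Two-dimensional lattices\<close>

definition zcomb :: "int ^ 2 \<Rightarrow> ('a::euclidean_space) ^ 2 \<Rightarrow> 'a" where
  "zcomb c b = (\<Sum>j\<in>UNIV. of_int (c $ j) *\<^sub>R (b $ j))"

text \<open>An ordered basis is a vector of vectors. Injectivity is required because \<^const>\<open>independent\<close>
  applies to sets, so it does not see a repeated vector.\<close>

definition lattice_basis :: "('a::euclidean_space) set \<Rightarrow> 'a ^ 2 \<Rightarrow> bool" where
  "lattice_basis L b \<longleftrightarrow>
     inj (($) b) \<and> independent (range (($) b)) \<and> L = range (\<lambda>c. zcomb c b)"

definition lattice2 :: "('a::euclidean_space) set \<Rightarrow> bool" where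
  "lattice2 L \<longleftrightarrow> (\<exists>b. lattice_basis L b)"

definition sublattice2 :: "('a::euclidean_space) set \<Rightarrow> 'a set \<Rightarrow> bool" where
  "sublattice2 M L \<longleftrightarrow> M \<subseteq> L \<and> lattice2 M"

definition unimodular_equivalent ::
    "('a::euclidean_space) set \<Rightarrow> 'a set \<Rightarrow> 'a set \<Rightarrow> bool" where
  "unimodular_equivalent L M N \<longleftrightarrow> (\<exists>\<sigma>. linear \<sigma> \<and> \<sigma> ` L = L \<and> \<sigma> ` M = N)"

section \<open>Coefficient matrices and invariant factors\<close>

text \<open>The family \<open>A \<star> b\<close> has as \<open>i\<close>-th vector the one whose coordinates with respect to \<open>b\<close>
  form the \<open>i\<close>-th row of \<open>A\<close>.\<close>

definition rowcomb :: "int ^ 2 ^ 2 \<Rightarrow> ('a::euclidean_space) ^ 2 \<Rightarrow> 'a ^ 2" (infixr "\<star>" 75) where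
  "A \<star> b = (\<chi> i. zcomb (A $ i) b)"

definition coefficient_matrix ::
    "('a::euclidean_space) set \<Rightarrow> 'a set \<Rightarrow> int ^ 2 ^ 2 \<Rightarrow> bool" where
  "coefficient_matrix L M A \<longleftrightarrow> (\<exists>b c. lattice_basis L b \<and> lattice_basis M c \<and> c = A \<star> b)"

definition diag2 :: "int \<Rightarrow> int \<Rightarrow> int ^ 2 ^ 2" where
  "diag2 d1 d2 = (\<chi> i j. if i = j then (if i = 1 then d1 else d2) else 0)"

text \<open>\<^const>\<open>invertible\<close> asks here for an inverse with integer entries.\<close>

definition smith_normal_form :: "int ^ 2 ^ 2 \<Rightarrow> int \<Rightarrow> int \<Rightarrow> bool" where
  "smith_normal_form A d1 d2 \<longleftrightarrow> 0 < d1 \<and> 0 < d2 \<and> d1 dvd d2 \<and>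
     (\<exists>P Q. invertible P \<and> invertible Q \<and> P ** A ** Q = diag2 d1 d2)"

text \<open>Independence of the chosen bases is \<open>invariant_factors_any_matrix\<close> and
  \<open>invariant_factors_unique\<close> below.\<close>

definition invariant_factors ::
    "('a::euclidean_space) set \<Rightarrow> 'a set \<Rightarrow> int \<Rightarrow> int \<Rightarrow> bool" where
  "invariant_factors L M d1 d2 \<longleftrightarrow> (\<exists>A. coefficient_matrix L M A \<and> smith_normal_form A d1 d2)"

text \<open>That this set is a unimodular equivalence class is \<open>S_class_nonempty\<close> and
  \<open>S_class_eq_class\<close> below.\<close>

definition S_class :: "('a::euclidean_space) set \<Rightarrow> nat \<Rightarrow> nat \<Rightarrow> nat \<Rightarrow> 'a set set" where
  "S_class L p a b = {M. sublattice2 M L \<and> invariant_factors L M (int p ^ a) (int p ^ b)}"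

definition f_class :: "('a::euclidean_space) set \<Rightarrow> nat \<Rightarrow> nat \<Rightarrow> nat \<Rightarrow> nat" where
  "f_class L p a b = card (S_class L p a b)"

section \<open>The notions are well defined\<close>

lemma zcomb_2: "zcomb c b = of_int (c $ 1) *\<^sub>R b $ 1 + of_int (c $ 2) *\<^sub>R b $ 2"
  by (simp add: zcomb_def sum_2)

lemma rowcomb_nth [simp]: "(A \<star> b) $ i = zcomb (A $ i) b"
  by (simp add: rowcomb_def)

lemma rowcomb_assoc: "A \<star> B \<star> b = (A ** B) \<star> b"
  by (simp add: vec_eq_iff zcomb_2 matrix_matrix_mult_def sum_2 algebra_simps)

lemma rowcomb_one [simp]: "mat 1 \<star> b = b"
  by (simp add: vec_eq_iff zcomb_2 mat_def forall_2)

lemma zcomb_rowcomb: "zcomb c (A \<star> b) = zcomb (c v* A) b"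
  by (simp add: zcomb_2 vector_matrix_mult_def sum_2 algebra_simps)

lemma indep_iff:
  fixes b :: "('a::euclidean_space) ^ 2"
  shows "inj (($) b) \<and> independent (range (($) b)) \<longleftrightarrow>
    (\<forall>x y. x *\<^sub>R b $ 1 + y *\<^sub>R b $ 2 = 0 \<longrightarrow> x = 0 \<and> y = 0)" (is "?l \<longleftrightarrow> ?r")
proof
  assume l: ?l
  have ne: "b $ 1 \<noteq> b $ 2"
    using l injD[of "($) b" 1 2] by auto
  show ?r
  proof (intro allI impI)
    fix x y assume 0: "x *\<^sub>R b $ 1 + y *\<^sub>R b $ 2 = 0"
    define u where "u v = (if v = b $ 1 then x else y)" for v
    have r: "range (($) b) = {b $ 1, b $ 2}" by (auto simp: UNIV_2)
    have "(\<Sum>v\<in>{b $ 1, b $ 2}. u v *\<^sub>R v) = 0"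
      using ne 0 by (simp add: u_def)
    then have "u v = 0" if "v \<in> {b $ 1, b $ 2}" for v
      using independentD[of "range (($) b)" "{b $ 1, b $ 2}" u v] l that unfolding r by auto
    then have "u (b $ 1) = 0" "u (b $ 2) = 0" by auto
    then show "x = 0 \<and> y = 0" using ne by (auto simp: u_def)
  qed
next
  assume r: ?r
  have ne: "b $ 1 \<noteq> b $ 2"
    using r[rule_format, of 1 "-1"] by auto
  have inj: "inj (($) b)"
    using ne by (auto simp: inj_def forall_2)
  moreover have "independent (range (($) b))"
  proof -
    have "u (b $ 1) = 0 \<and> u (b $ 2) = 0" if "(\<Sum>v\<in>{b $ 1, b $ 2}. u v *\<^sub>R v) = 0" for u
      using that ne r by simp
    moreover have "range (($) b) = {b $ 1, b $ 2}" by (auto simp: UNIV_2)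
    ultimately show ?thesis
      by (intro independent_if_scalars_zero) auto
  qed
  ultimately show ?l by simp
qed

lemma zcomb_inj:
  assumes "lattice_basis L b" "zcomb c b = zcomb d b"
  shows "c = d"
proof -
  have "real_of_int (c $ 1 - d $ 1) *\<^sub>R b $ 1 + real_of_int (c $ 2 - d $ 2) *\<^sub>R b $ 2 = 0"
    using assms(2) by (simp add: zcomb_2 algebra_simps)
  moreover have "\<forall>x y. x *\<^sub>R b $ 1 + y *\<^sub>R b $ 2 = 0 \<longrightarrow> x = 0 \<and> y = 0"
    using assms(1) indep_iff[of b] unfolding lattice_basis_def by blast
  ultimately have "real_of_int (c $ 1 - d $ 1) = 0 \<and> real_of_int (c $ 2 - d $ 2) = 0"
    by blast
  then show ?thesis by (simp add: vec_eq_iff forall_2)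
qed

lemma rowcomb_inj: "lattice_basis L b \<Longrightarrow> A \<star> b = B \<star> b \<Longrightarrow> A = B"
  by (metis vec_eq_iff rowcomb_nth zcomb_inj)

lemma int_left_inverse:
  fixes P Q :: "int ^ 2 ^ 2"
  assumes "Q ** P = mat 1"
  shows "P ** Q = mat 1"
proof -
  define R where "R A = (\<chi> i j. real_of_int (A $ i $ j))" for A :: "int ^ 2 ^ 2"
  have R: "R A = R B \<longleftrightarrow> A = B" for A B by (simp add: R_def vec_eq_iff)
  have mult: "R (A ** B) = R A ** R B" for A B
    by (simp add: R_def vec_eq_iff matrix_matrix_mult_def)
  have one: "R (mat 1) = mat 1" by (simp add: R_def vec_eq_iff mat_def)
  from assms have "R Q ** R P = mat 1" by (metis mult one)
  then have "R P ** R Q = mat 1" by (simp add: matrix_left_right_inverse)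
  then show ?thesis by (metis mult one R)
qed

lemma invertibleI_int: "Q ** P = mat 1 \<Longrightarrow> invertible P" for P Q :: "int ^ 2 ^ 2"
  unfolding invertible_def using int_left_inverse by blast

lemma generates_coeffs:
  assumes "\<And>i. c $ i \<in> range (\<lambda>d. zcomb d b)"
  shows "\<exists>A. c = A \<star> b"
proof -
  have "\<forall>i. \<exists>d. c $ i = zcomb d b" using assms by blast
  then obtain f where "\<And>i. c $ i = zcomb (f i) b" by (auto dest: choice)
  then show ?thesis by (intro exI[of _ "\<chi> i. f i"]) (simp add: vec_eq_iff)
qed

lemma basis_nth:
  assumes "lattice_basis L b" shows "b $ i \<in> L"
proof -
  have "b $ i = zcomb (axis i 1) b"
    using exhaust_2[of i] by (auto simp: zcomb_2 axis_def)
  then show ?thesis using assms by (auto simp: lattice_basis_def)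
qed

lemma basis_coeffs:
  assumes "lattice_basis L b" "\<And>i. c $ i \<in> L"
  shows "\<exists>A. c = A \<star> b"
  using generates_coeffs[of c b] assms by (auto simp: lattice_basis_def)

lemma basis_change:
  assumes "lattice_basis L b" "lattice_basis L c"
  obtains P where "invertible P" "c = P \<star> b"
proof -
  obtain P where P: "c = P \<star> b"
    using basis_coeffs[of L b c, OF assms(1) basis_nth[OF assms(2)]] by blast
  obtain Q where Q: "b = Q \<star> c"
    using basis_coeffs[of L c b, OF assms(2) basis_nth[OF assms(1)]] by blast
  have "(Q ** P) \<star> b = mat 1 \<star> b" using P Q by (simp add: rowcomb_assoc[symmetric])
  then have "Q ** P = mat 1" using rowcomb_inj assms(1) by blast
  with P that invertibleI_int show thesis by blast
qed

lemma basis_transform: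
  assumes b: "lattice_basis L b" and P: "invertible P"
  shows "lattice_basis L (P \<star> b)"
proof -
  obtain Q where Q: "Q ** P = mat 1" "P ** Q = mat 1"
    using P by (auto simp: invertible_def)
  have q: "Q$1$1 * P$1$1 + Q$1$2 * P$2$1 = 1" "Q$1$1 * P$1$2 + Q$1$2 * P$2$2 = 0"
      "Q$2$1 * P$1$1 + Q$2$2 * P$2$1 = 0" "Q$2$1 * P$1$2 + Q$2$2 * P$2$2 = 1"
      "P$1$1 * Q$1$1 + P$1$2 * Q$2$1 = 1" "P$1$1 * Q$1$2 + P$1$2 * Q$2$2 = 0"
      "P$2$1 * Q$1$1 + P$2$2 * Q$2$1 = 0" "P$2$1 * Q$1$2 + P$2$2 * Q$2$2 = 1"
    using Q by (simp_all add: vec_eq_iff forall_2 matrix_matrix_mult_def sum_2 mat_def)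
  have i: "\<forall>x y. x *\<^sub>R b $ 1 + y *\<^sub>R b $ 2 = 0 \<longrightarrow> x = 0 \<and> y = 0"
    using b indep_iff[of b] unfolding lattice_basis_def by blast
  have "\<forall>x y. x *\<^sub>R (P \<star> b) $ 1 + y *\<^sub>R (P \<star> b) $ 2 = 0 \<longrightarrow> x = 0 \<and> y = 0"
  proof (intro allI impI)
    fix x y assume "x *\<^sub>R (P \<star> b) $ 1 + y *\<^sub>R (P \<star> b) $ 2 = 0"
    then have "(x * P$1$1 + y * P$2$1) *\<^sub>R b $ 1 + (x * P$1$2 + y * P$2$2) *\<^sub>R b $ 2 = 0"
      by (simp add: zcomb_2 algebra_simps)
    with i have 0: "x * P$1$1 + y * P$2$1 = 0" "x * P$1$2 + y * P$2$2 = 0" by blast+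
    have "x = x * (P$1$1 * Q$1$1 + P$1$2 * Q$2$1) + y * (P$2$1 * Q$1$1 + P$2$2 * Q$2$1)"
      unfolding q by simp
    also have "\<dots> = (x * P$1$1 + y * P$2$1) * Q$1$1 + (x * P$1$2 + y * P$2$2) * Q$2$1"
      by (simp add: algebra_simps)
    finally have x: "x = 0" using 0 by simp
    have "y = x * (P$1$1 * Q$1$2 + P$1$2 * Q$2$2) + y * (P$2$1 * Q$1$2 + P$2$2 * Q$2$2)"
      unfolding q by simp
    also have "\<dots> = (x * P$1$1 + y * P$2$1) * Q$1$2 + (x * P$1$2 + y * P$2$2) * Q$2$2"
      by (simp add: algebra_simps)
    also have "\<dots> = 0" unfolding 0 by simp
    finally show "x = 0 \<and> y = 0" using x by blast
  qed
  then have "inj (($) (P \<star> b)) \<and> independent (range (($) (P \<star> b)))"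
    using indep_iff by blast
  moreover have "range (\<lambda>c. zcomb c (P \<star> b)) = range (\<lambda>c. zcomb c b)"
  proof -
    have "zcomb c b = zcomb (c v* Q) (P \<star> b)" for c
      by (metis zcomb_rowcomb rowcomb_assoc Q(1) rowcomb_one)
    then show ?thesis by (auto simp: zcomb_rowcomb)
  qed
  ultimately show ?thesis using b by (simp add: lattice_basis_def)
qed

lemma invertible_mult_int:
  fixes P Q :: "int ^ 2 ^ 2"
  assumes "invertible P" "invertible Q"
  shows "invertible (P ** Q)"
proof -
  obtain P' Q' where "P' ** P = mat 1" "Q' ** Q = mat 1"
    using assms by (auto simp: invertible_def)
  then have "(Q' ** P') ** (P ** Q) = mat 1"
    by (metis matrix_mul_assoc matrix_mul_lid)
  then show ?thesis by (rule invertibleI_int)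
qed

lemma invertible_inverse_int:
  fixes P :: "int ^ 2 ^ 2"
  assumes "invertible P"
  obtains Q where "invertible Q" "P ** Q = mat 1" "Q ** P = mat 1"
  using assms unfolding invertible_def by blast

theorem invariant_factors_any_matrix:
  assumes "invariant_factors L M d1 d2" "coefficient_matrix L M B"
  shows "smith_normal_form B d1 d2"
proof -
  obtain A b c P Q where A: "lattice_basis L b" "lattice_basis M c" "c = A \<star> b"
    "invertible P" "invertible Q" "P ** A ** Q = diag2 d1 d2" "0 < d1" "0 < d2" "d1 dvd d2"
    using assms(1) unfolding invariant_factors_def coefficient_matrix_def smith_normal_form_def
    by blast
  obtain b' c' where B: "lattice_basis L b'" "lattice_basis M c'" "c' = B \<star> b'"
    using assms(2) unfolding coefficient_matrix_def by blast
  obtain U where U: "invertible U" "b' = U \<star> b" using basis_change[OF A(1) B(1)] by blast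
  obtain V where V: "invertible V" "c = V \<star> c'" using basis_change[OF B(2) A(2)] by blast
  have "A \<star> b = (V ** B ** U) \<star> b"
    using A(3) U V B(3) by (metis rowcomb_assoc)
  then have "A = V ** B ** U" using rowcomb_inj A(1) by blast
  then have "(P ** V) ** B ** (U ** Q) = diag2 d1 d2"
    using A(6) by (simp add: matrix_mul_assoc)
  then show ?thesis unfolding smith_normal_form_def
    using A(7-9) invertible_mult_int[OF A(4) V(1)] invertible_mult_int[OF U(1) A(5)] by blast
qed

lemma smith_dvd:
  assumes "P ** diag2 d1 d2 ** Q = diag2 e1 e2" "d1 dvd d2"
  shows "d1 dvd e1"
proof -
  have "(P ** diag2 d1 d2 ** Q) $ 1 $ 1 = e1" using assms(1) by (simp add: diag2_def)
  then have "e1 = P$1$1 * d1 * Q$1$1 + P$1$2 * d2 * Q$2$1"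
    by (simp add: diag2_def matrix_matrix_mult_def sum_2)
  then show ?thesis using assms(2) by simp
qed

lemma smith_normal_form_unique:
  assumes "smith_normal_form A d1 d2" "smith_normal_form A e1 e2"
  shows "d1 = e1 \<and> d2 = e2"
proof -
  obtain P Q where d: "0 < d1" "0 < d2" "d1 dvd d2" "invertible P" "invertible Q"
      "P ** A ** Q = diag2 d1 d2"
    using assms(1) unfolding smith_normal_form_def by blast
  obtain U V where e: "0 < e1" "0 < e2" "e1 dvd e2" "invertible U" "invertible V"
      "U ** A ** V = diag2 e1 e2"
    using assms(2) unfolding smith_normal_form_def by blast
  obtain P' where P': "invertible P'" "P' ** P = mat 1" using d invertible_inverse_int by blast
  obtain Q' where Q': "invertible Q'" "Q ** Q' = mat 1" using d invertible_inverse_int by blast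
  obtain U' where U': "invertible U'" "U' ** U = mat 1" using e invertible_inverse_int by blast
  obtain V' where V': "invertible V'" "V ** V' = mat 1" using e invertible_inverse_int by blast
  have "P' ** diag2 d1 d2 ** Q' = (P' ** P) ** A ** (Q ** Q')"
    by (simp add: d(6)[symmetric] matrix_mul_assoc)
  then have A1: "A = P' ** diag2 d1 d2 ** Q'" using P' Q' by simp
  have "U' ** diag2 e1 e2 ** V' = (U' ** U) ** A ** (V ** V')"
    by (simp add: e(6)[symmetric] matrix_mul_assoc)
  then have A2: "A = U' ** diag2 e1 e2 ** V'" using U' V' by simp
  have de: "(U ** P') ** diag2 d1 d2 ** (Q' ** V) = diag2 e1 e2"
    using e(6) A1 by (simp add: matrix_mul_assoc)
  have ed: "(P ** U') ** diag2 e1 e2 ** (V' ** Q) = diag2 d1 d2"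
    using d(6) A2 by (simp add: matrix_mul_assoc)
  have dd: "det (diag2 x y) = x * y" for x y by (simp add: det_2 diag2_def)
  have 1: "d1 = e1"
    using smith_dvd[OF de d(3)] smith_dvd[OF ed e(3)] d e by (simp add: zdvd_antisym_nonneg)
  have "d1 * d2 dvd e1 * e2"
    using arg_cong[OF de, of det, symmetric] by (simp add: det_mul dd)
  moreover have "e1 * e2 dvd d1 * d2"
    using arg_cong[OF ed, of det, symmetric] by (simp add: det_mul dd)
  ultimately have "d1 * d2 = e1 * e2" using d e by (simp add: zdvd_antisym_nonneg)
  with 1 d show ?thesis by simp
qed

theorem invariant_factors_unique:
  assumes "invariant_factors L M d1 d2" "invariant_factors L M e1 e2"
  shows "d1 = e1 \<and> d2 = e2"
  using assms invariant_factors_any_matrix smith_normal_form_unique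
  unfolding invariant_factors_def by metis

lemma invariant_factors_iff:
  "invariant_factors L M d1 d2 \<longleftrightarrow> 0 < d1 \<and> 0 < d2 \<and> d1 dvd d2 \<and>
     (\<exists>b. lattice_basis L b \<and> lattice_basis M (diag2 d1 d2 \<star> b))" (is "?l \<longleftrightarrow> ?r")
proof
  assume ?l
  then obtain A b c P Q where A: "lattice_basis L b" "lattice_basis M c" "c = A \<star> b"
    "invertible P" "invertible Q" "P ** A ** Q = diag2 d1 d2" "0 < d1" "0 < d2" "d1 dvd d2"
    unfolding invariant_factors_def coefficient_matrix_def smith_normal_form_def
    by blast
  obtain Q' where Q': "invertible Q'" "Q ** Q' = mat 1" using A invertible_inverse_int by blast
  have "diag2 d1 d2 \<star> Q' \<star> b = (P ** A ** (Q ** Q')) \<star> b"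
    by (simp add: rowcomb_assoc A(6)[symmetric] matrix_mul_assoc)
  also have "\<dots> = P \<star> c" using Q' A by (simp add: rowcomb_assoc)
  finally have "lattice_basis M (diag2 d1 d2 \<star> Q' \<star> b)" using basis_transform A by metis
  then show ?r using A basis_transform Q' by blast
next
  assume r: ?r
  then obtain b where "lattice_basis L b" "lattice_basis M (diag2 d1 d2 \<star> b)" by blast
  then have "coefficient_matrix L M (diag2 d1 d2)" unfolding coefficient_matrix_def by blast
  moreover have "invertible (mat 1 :: int ^ 2 ^ 2)" by (rule invertibleI_int[of "mat 1"]) simp
  then have "smith_normal_form (diag2 d1 d2) d1 d2"
    unfolding smith_normal_form_def using r by (metis matrix_mul_lid matrix_mul_rid)
  ultimately show ?l unfolding invariant_factors_def by blast
qed

definition map_basis :: "('a::euclidean_space \<Rightarrow> 'a) \<Rightarrow> 'a ^ 2 \<Rightarrow> 'a ^ 2" where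
  "map_basis \<sigma> b = (\<chi> i. \<sigma> (b $ i))"

lemma map_basis_zcomb: "linear \<sigma> \<Longrightarrow> \<sigma> (zcomb c b) = zcomb c (map_basis \<sigma> b)"
  by (simp add: zcomb_2 map_basis_def linear_add linear_cmul)

lemma map_basis_rowcomb: "linear \<sigma> \<Longrightarrow> map_basis \<sigma> (A \<star> b) = A \<star> map_basis \<sigma> b"
  by (simp add: vec_eq_iff map_basis_zcomb[symmetric] map_basis_def[of _ "A \<star> b"])

lemma map_basis_range:
  "linear \<sigma> \<Longrightarrow> lattice_basis L b \<Longrightarrow> \<sigma> ` L = range (\<lambda>c. zcomb c (map_basis \<sigma> b))"
  by (simp add: lattice_basis_def image_image map_basis_zcomb)

lemma automorphism_basis:
  assumes "linear \<sigma>" "\<sigma> ` L = L" "lattice_basis L b"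
  shows "lattice_basis L (map_basis \<sigma> b)"
proof -
  have L: "L = range (\<lambda>c. zcomb c (map_basis \<sigma> b))" using map_basis_range assms by metis
  obtain Q where Q: "b = Q \<star> map_basis \<sigma> b"
    using generates_coeffs[of b "map_basis \<sigma> b"] basis_nth[OF assms(3)] L by blast
  have "map_basis \<sigma> b $ i \<in> L" for i
    using basis_nth[OF assms(3)] assms(2) by (auto simp: map_basis_def)
  then obtain P where P: "map_basis \<sigma> b = P \<star> b"
    using basis_coeffs[OF assms(3)] by blast
  have "(Q ** P) \<star> b = mat 1 \<star> b" using P Q by (simp add: rowcomb_assoc[symmetric])
  then have "Q ** P = mat 1" using rowcomb_inj assms(3) by blast
  then show ?thesis using P basis_transform assms(3) invertibleI_int by metis
qed

lemma diag_indep: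
  fixes b :: "('a::euclidean_space) ^ 2"
  assumes "d1 \<noteq> 0" "d2 \<noteq> 0" "inj (($) b) \<and> independent (range (($) b))"
  shows "inj (($) (diag2 d1 d2 \<star> b)) \<and> independent (range (($) (diag2 d1 d2 \<star> b)))"
  using assms(1,2) assms(3)[unfolded indep_iff] unfolding indep_iff
  by (fastforce simp: zcomb_2 diag2_def)

lemma diag_sublattice:
  assumes "d1 \<noteq> 0" "d2 \<noteq> 0" "lattice_basis L b"
  shows "lattice_basis (range (\<lambda>c. zcomb c (diag2 d1 d2 \<star> b))) (diag2 d1 d2 \<star> b)"
    and "sublattice2 (range (\<lambda>c. zcomb c (diag2 d1 d2 \<star> b))) L"
proof -
  show *: "lattice_basis (range (\<lambda>c. zcomb c (diag2 d1 d2 \<star> b))) (diag2 d1 d2 \<star> b)"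
    unfolding lattice_basis_def
    using diag_indep assms unfolding lattice_basis_def by blast
  show "sublattice2 (range (\<lambda>c. zcomb c (diag2 d1 d2 \<star> b))) L"
    using * assms(3) unfolding sublattice2_def lattice2_def lattice_basis_def[of L]
    by (auto simp: zcomb_rowcomb)
qed

theorem S_class_nonempty:
  assumes "lattice2 L" "p > 0" "a \<le> b"
  shows "S_class L p a b \<noteq> {}"
proof -
  obtain e where e: "lattice_basis L e" using assms by (auto simp: lattice2_def)
  let ?D = "diag2 (int p ^ a) (int p ^ b)"
  have "range (\<lambda>c. zcomb c (?D \<star> e)) \<in> S_class L p a b"
    using diag_sublattice[OF _ _ e, of "int p ^ a" "int p ^ b"] e assms
    by (auto simp: S_class_def invariant_factors_iff le_imp_power_dvd)
  then show ?thesis by blast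
qed

theorem unimodular_equivalent_iff:
  assumes "invariant_factors L M d1 d2"
  shows "unimodular_equivalent L M N \<longleftrightarrow> invariant_factors L N d1 d2" (is "?l \<longleftrightarrow> ?r")
proof -
  let ?D = "diag2 d1 d2"
  obtain b where b: "lattice_basis L b" "lattice_basis M (?D \<star> b)"
    and d: "0 < d1" "0 < d2" "d1 dvd d2"
    using assms by (auto simp: invariant_factors_iff)
  show ?thesis
  proof
    assume ?l
    then obtain \<sigma> where \<sigma>: "linear \<sigma>" "\<sigma> ` L = L" "\<sigma> ` M = N"
      by (auto simp: unimodular_equivalent_def)
    have 1: "lattice_basis L (map_basis \<sigma> b)" using automorphism_basis \<sigma> b by blast
    have "N = range (\<lambda>c. zcomb c (?D \<star> map_basis \<sigma> b))"
      using map_basis_range[OF \<sigma>(1) b(2)] \<sigma> by (simp add: map_basis_rowcomb)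
    then have "lattice_basis N (?D \<star> map_basis \<sigma> b)" using diag_sublattice(1)[OF _ _ 1] d by auto
    with 1 d show ?r by (auto simp: invariant_factors_iff)
  next
    assume ?r
    then obtain b' where b': "lattice_basis L b'" "lattice_basis N (?D \<star> b')"
      by (auto simp: invariant_factors_iff)
    have inj: "inj (($) b)" and ind: "independent (range (($) b))"
      using b by (auto simp: lattice_basis_def)
    obtain \<sigma> where \<sigma>: "linear \<sigma>" "\<forall>x\<in>range (($) b). \<sigma> x = b' $ (inv (($) b) x)"
      using linear_independent_extend[OF ind, of "\<lambda>x. b' $ (inv (($) b) x)"] by blast
    have m: "map_basis \<sigma> b = b'" using \<sigma>(2) inj by (simp add: map_basis_def vec_eq_iff)
    have "\<sigma> ` L = L" using map_basis_range[OF \<sigma>(1) b(1)] b' m by (simp add: lattice_basis_def)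
    moreover have "\<sigma> ` M = N"
      using map_basis_range[OF \<sigma>(1) b(2)] b' m \<sigma>(1)
      by (simp add: lattice_basis_def map_basis_rowcomb)
    ultimately show ?l using \<sigma>(1) unfolding unimodular_equivalent_def by blast
  qed
qed

theorem S_class_eq_class:
  assumes "M \<in> S_class L p a b"
  shows "S_class L p a b = {N. sublattice2 N L \<and> unimodular_equivalent L M N}"
  using assms unimodular_equivalent_iff[of L M "int p ^ a" "int p ^ b"]
  by (auto simp: S_class_def)

end

theory Submission
  imports Defs "HOL-Number_Theory.Cong"
begin

text \<open>
  The idea is to count points of the projective line over \<open>\<int>/N\<close>. Fix a basis \<open>e\<close> of \<open>\<Lambda>\<close>.
  A sublattice with invariant factors \<open>q\<close> and \<open>q N\<close> has the form \<open>\<int> q b\<^sub>1 + \<int> q N b\<^sub>2\<close>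
  for some basis \<open>b\<close> of \<open>\<Lambda>\<close>. It therefore consists of the vectors \<open>q v\<close> for which the second
  \<open>b\<close>-coordinate of \<open>v\<close> is divisible by \<open>N\<close>. In the coordinates \<open>x, y\<close> with respect to \<open>e\<close> this
  is a single congruence \<open>\<alpha> x + \<beta> y \<equiv> 0 (mod N)\<close> with \<open>\<alpha>\<close>, \<open>\<beta>\<close> coprime, and every coprime pair
  arises, because it can be completed to a unimodular matrix (\<open>invariant_factors_iff_congruence\<close>).

  Multiplying \<open>(\<alpha>, \<beta>)\<close> by a unit modulo \<open>N\<close> does not change the congruence. For \<open>N = p\<^sup>k\<close> with
  \<open>k > 0\<close> one of \<open>\<alpha>\<close>, \<open>\<beta>\<close> is a unit, so the pair can be normalised either to \<open>(1, x)\<close> with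
  \<open>0 \<le> x < p\<^sup>k\<close>, or, if \<open>p\<close> divides \<open>\<alpha>\<close>, to \<open>(p y, 1)\<close> with \<open>0 \<le> y < p\<^sup>k\<^sup>-\<^sup>1\<close>
  (\<open>congruence_sublattice_normal_form\<close>). Different normalised pairs give different sublattices,
  which yields \<open>p\<^sup>k + p\<^sup>k\<^sup>-\<^sup>1\<close> of them. The theorem is the case \<open>q = p\<^sup>t\<close>, \<open>k = r - 2 t\<close>.
  For \<open>k = 0\<close> the congruence is void and \<open>q \<Lambda>\<close> is the only sublattice of the class.
\<close>

definition congruence_sublattice ::
    "('a::euclidean_space) ^ 2 \<Rightarrow> int \<Rightarrow> int \<Rightarrow> int \<Rightarrow> int \<Rightarrow> 'a set" where
  "congruence_sublattice e q N \<alpha> \<beta> =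
     {of_int (q * x) *\<^sub>R e $ 1 + of_int (q * y) *\<^sub>R e $ 2 | x y. N dvd \<alpha> * x + \<beta> * y}"

text \<open>The coordinates of a vector are unique, so the congruence can be read off from the set.\<close>

lemma mem_congruence_sublattice_iff:
  assumes "lattice_basis L e" "q \<noteq> 0"
  shows "of_int (q * x) *\<^sub>R e $ 1 + of_int (q * y) *\<^sub>R e $ 2 \<in> congruence_sublattice e q N \<alpha> \<beta>
    \<longleftrightarrow> N dvd \<alpha> * x + \<beta> * y" (is "?v \<in> _ \<longleftrightarrow> _")
proof
  assume "?v \<in> congruence_sublattice e q N \<alpha> \<beta>"
  then obtain x' y' where d: "N dvd \<alpha> * x' + \<beta> * y'"
    and v: "?v = of_int (q * x') *\<^sub>R e $ 1 + of_int (q * y') *\<^sub>R e $ 2"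
    unfolding congruence_sublattice_def by blast
  have "zcomb (vector [q * x, q * y]) e = zcomb (vector [q * x', q * y']) e"
    using v by (simp only: zcomb_2 vector_2)
  then have "(vector [q * x, q * y] :: int ^ 2) = vector [q * x', q * y']"
    using zcomb_inj assms(1) by blast
  then have "q * x = q * x'" "q * y = q * y'" by (metis vector_2)+
  then show "N dvd \<alpha> * x + \<beta> * y" using d assms(2) by simp
next
  assume "N dvd \<alpha> * x + \<beta> * y"
  then show "?v \<in> congruence_sublattice e q N \<alpha> \<beta>"
    unfolding congruence_sublattice_def by blast
qed

text \<open>The linear form on the right is the second coordinate with respect to the basis \<open>P \<star> e\<close>:
  a row of \<open>e\<close>-coordinates is turned into \<open>P \<star> e\<close>-coordinates by multiplication with \<open>Q\<close> from
  the right, so the second column of \<open>Q\<close> supplies the coefficients.\<close>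

lemma diagonal_sublattice_eq_congruence:
  assumes "P ** Q = mat 1" "Q ** P = mat 1"
  shows "range (\<lambda>c. zcomb c (diag2 q (q * N) \<star> P \<star> e)) =
    congruence_sublattice e q N (Q $ 1 $ 2) (Q $ 2 $ 2)"
proof -
  have inv: "P$1$1 * Q$1$2 + P$1$2 * Q$2$2 = 0" "P$2$1 * Q$1$2 + P$2$2 * Q$2$2 = 1"
      "Q$1$1 * P$1$1 + Q$1$2 * P$2$1 = 1" "Q$1$1 * P$1$2 + Q$1$2 * P$2$2 = 0"
      "Q$2$1 * P$1$1 + Q$2$2 * P$2$1 = 0" "Q$2$1 * P$1$2 + Q$2$2 * P$2$2 = 1"
    using assms by (simp_all add: vec_eq_iff forall_2 matrix_matrix_mult_def sum_2 mat_def)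
  have coords: "zcomb c (diag2 q (q * N) \<star> P \<star> e) =
      of_int (q * (c$1 * P$1$1 + N * c$2 * P$2$1)) *\<^sub>R e $ 1 +
      of_int (q * (c$1 * P$1$2 + N * c$2 * P$2$2)) *\<^sub>R e $ 2" for c
    by (simp add: zcomb_2 diag2_def algebra_simps)
  show ?thesis
  proof
    show "range (\<lambda>c. zcomb c (diag2 q (q * N) \<star> P \<star> e)) \<subseteq>
        congruence_sublattice e q N (Q $ 1 $ 2) (Q $ 2 $ 2)"
    proof
      fix v assume "v \<in> range (\<lambda>c. zcomb c (diag2 q (q * N) \<star> P \<star> e))"
      then obtain c where v: "v = zcomb c (diag2 q (q * N) \<star> P \<star> e)" by blast
      let ?x = "c$1 * P$1$1 + N * c$2 * P$2$1" and ?y = "c$1 * P$1$2 + N * c$2 * P$2$2"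
      have "Q$1$2 * ?x + Q$2$2 * ?y =
          c$1 * (P$1$1 * Q$1$2 + P$1$2 * Q$2$2) + N * c$2 * (P$2$1 * Q$1$2 + P$2$2 * Q$2$2)"
        by (simp add: algebra_simps)
      then have "N dvd Q$1$2 * ?x + Q$2$2 * ?y" unfolding inv by simp
      then show "v \<in> congruence_sublattice e q N (Q $ 1 $ 2) (Q $ 2 $ 2)"
        unfolding v coords congruence_sublattice_def by blast
    qed
    show "congruence_sublattice e q N (Q $ 1 $ 2) (Q $ 2 $ 2) \<subseteq>
        range (\<lambda>c. zcomb c (diag2 q (q * N) \<star> P \<star> e))"
    proof
      fix v assume "v \<in> congruence_sublattice e q N (Q $ 1 $ 2) (Q $ 2 $ 2)"
      then obtain x y where v: "v = of_int (q * x) *\<^sub>R e $ 1 + of_int (q * y) *\<^sub>R e $ 2"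
        and "N dvd Q$1$2 * x + Q$2$2 * y"
        unfolding congruence_sublattice_def by blast
      then obtain k where k: "Q$1$2 * x + Q$2$2 * y = N * k" by blast
      define c :: "int ^ 2" where "c = vector [x * Q$1$1 + y * Q$2$1, k]"
      have c: "c$1 = x * Q$1$1 + y * Q$2$1" "N * c$2 = Q$1$2 * x + Q$2$2 * y"
        by (simp_all add: c_def k)
      have "c$1 * P$1$1 + N * c$2 * P$2$1 =
          x * (Q$1$1 * P$1$1 + Q$1$2 * P$2$1) + y * (Q$2$1 * P$1$1 + Q$2$2 * P$2$1)"
        unfolding c by (simp add: algebra_simps)
      then have x: "c$1 * P$1$1 + N * c$2 * P$2$1 = x" unfolding inv by simp
      have "c$1 * P$1$2 + N * c$2 * P$2$2 =
          x * (Q$1$1 * P$1$2 + Q$1$2 * P$2$2) + y * (Q$2$1 * P$1$2 + Q$2$2 * P$2$2)"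
        unfolding c by (simp add: algebra_simps)
      then have y: "c$1 * P$1$2 + N * c$2 * P$2$2 = y" unfolding inv by simp
      have "v = zcomb c (diag2 q (q * N) \<star> P \<star> e)" unfolding coords x y v ..
      then show "v \<in> range (\<lambda>c. zcomb c (diag2 q (q * N) \<star> P \<star> e))" by blast
    qed
  qed
qed

text \<open>A pair of integers is a column of a unimodular matrix if and only if it is coprime. Hence the
  second coordinates with respect to the bases of \<open>L\<close> are precisely the coprime linear forms.\<close>

lemma invariant_factors_iff_congruence:
  assumes e: "lattice_basis L e" and q: "q > 0" and N: "N > 0"
  shows "sublattice2 M L \<and> invariant_factors L M q (q * N) \<longleftrightarrow>
    (\<exists>\<alpha> \<beta>. coprime \<alpha> \<beta> \<and> M = congruence_sublattice e q N \<alpha> \<beta>)" (is "?l \<longleftrightarrow> ?r")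
proof
  assume ?l
  then obtain b where b: "lattice_basis L b" "lattice_basis M (diag2 q (q * N) \<star> b)"
    by (auto simp: invariant_factors_iff)
  obtain P where P: "invertible P" "b = P \<star> e" using basis_change[OF e b(1)] by blast
  obtain Q where Q: "P ** Q = mat 1" "Q ** P = mat 1"
    using invertible_inverse_int P(1) by blast
  have "P$2$1 * Q$1$2 + P$2$2 * Q$2$2 = 1"
    using Q(1) by (simp add: vec_eq_iff forall_2 matrix_matrix_mult_def sum_2 mat_def)
  then have "coprime (Q$1$2) (Q$2$2)"
    by (intro coprimeI) (metis dvd_add dvd_mult)
  moreover have "M = congruence_sublattice e q N (Q $ 1 $ 2) (Q $ 2 $ 2)"
    using b(2) diagonal_sublattice_eq_congruence[OF Q] P(2) by (simp add: lattice_basis_def)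
  ultimately show ?r by blast
next
  assume ?r
  then obtain \<alpha> \<beta> where \<alpha>\<beta>: "coprime \<alpha> \<beta>" and M: "M = congruence_sublattice e q N \<alpha> \<beta>" by blast
  obtain u v where uv: "u * \<alpha> + v * \<beta> = 1" using bezout_int[of \<alpha> \<beta>] \<alpha>\<beta> by auto
  define P :: "int ^ 2 ^ 2" where "P = vector [vector [\<beta>, - \<alpha>], vector [u, v]]"
  define Q :: "int ^ 2 ^ 2" where "Q = vector [vector [v, \<alpha>], vector [- u, \<beta>]]"
  have Q: "P ** Q = mat 1" "Q ** P = mat 1"
    using uv by (simp_all add: P_def Q_def vec_eq_iff forall_2 matrix_matrix_mult_def sum_2 mat_def
        algebra_simps)
  have b: "lattice_basis L (P \<star> e)" using basis_transform[OF e] Q by (auto simp: invertible_def)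
  have "M = range (\<lambda>c. zcomb c (diag2 q (q * N) \<star> P \<star> e))"
    using diagonal_sublattice_eq_congruence[OF Q, of q N e] M by (simp add: Q_def)
  then show ?l
    using diag_sublattice[OF _ _ b, of q "q * N"] b q N by (auto simp: invariant_factors_iff)
qed

text \<open>A factor coprime to \<open>N\<close> can be cancelled in a divisibility by \<open>N\<close>. Taking for \<open>u\<close> the inverse
  of a unit coefficient normalises that coefficient to \<open>1\<close>.\<close>

lemma congruence_sublattice_cong:
  assumes u: "coprime u N" and "[\<alpha>' = u * \<alpha>] (mod N)" "[\<beta>' = u * \<beta>] (mod N)"
  shows "congruence_sublattice e q N \<alpha>' \<beta>' = congruence_sublattice e q N \<alpha> \<beta>"
proof -
  have "N dvd \<alpha>' * x + \<beta>' * y \<longleftrightarrow> N dvd \<alpha> * x + \<beta> * y" for x y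
  proof -
    have "[\<alpha>' * x + \<beta>' * y = u * \<alpha> * x + u * \<beta> * y] (mod N)"
      using assms by (intro cong_add cong_mult) auto
    then have "N dvd \<alpha>' * x + \<beta>' * y \<longleftrightarrow> N dvd u * (\<alpha> * x + \<beta> * y)"
      by (simp add: cong_dvd_iff algebra_simps)
    also have "\<dots> \<longleftrightarrow> N dvd \<alpha> * x + \<beta> * y"
      using u by (simp add: coprime_dvd_mult_right_iff coprime_commute)
    finally show ?thesis .
  qed
  then show ?thesis by (simp add: congruence_sublattice_def)
qed

text \<open>The second family runs only over multiples of \<open>p\<close>, because a pair \<open>(\<alpha>, 1)\<close> with \<open>\<alpha>\<close> a unit
  can be rescaled to a pair of the first family.\<close>

lemma congruence_sublattice_normal_form:
  fixes p :: int
  assumes p: "prime p" and k: "k > 0"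
  shows "{congruence_sublattice e q (p ^ k) \<alpha> \<beta> | \<alpha> \<beta>. coprime \<alpha> \<beta>} =
    (\<lambda>x. congruence_sublattice e q (p ^ k) 1 x) ` {0..<p ^ k} \<union>
    (\<lambda>y. congruence_sublattice e q (p ^ k) (p * y) 1) ` {0..<p ^ (k - 1)}"
    (is "?l = ?A \<union> ?B")
proof
  have pos: "p > 0" using p prime_gt_0_int by blast
  have pk: "p ^ k = p * p ^ (k - 1)" using k by (simp add: power_eq_if)
  show "?l \<subseteq> ?A \<union> ?B"
  proof
    fix M assume "M \<in> ?l"
    then obtain \<alpha> \<beta> where c: "coprime \<alpha> \<beta>" and M: "M = congruence_sublattice e q (p ^ k) \<alpha> \<beta>"
      by blast
    show "M \<in> ?A \<union> ?B"
    proof (cases "p dvd \<alpha>")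
      case False
      then have "coprime \<alpha> (p ^ k)"
        using p by (metis coprime_commute coprime_power_right_iff prime_imp_coprime)
      then obtain u where u: "[\<alpha> * u = 1] (mod p ^ k)" using cong_solve_coprime_int by blast
      then have "coprime u (p ^ k)" by (metis coprime_iff_invertible_int mult.commute)
      then have "M = congruence_sublattice e q (p ^ k) 1 (u * \<beta> mod p ^ k)"
        unfolding M using u
        by (intro congruence_sublattice_cong[symmetric, of u])
          (auto simp: mult.commute cong_sym)
      moreover have "u * \<beta> mod p ^ k \<in> {0..<p ^ k}" using pos by simp
      ultimately show ?thesis by blast
    next
      case True
      then have "\<not> p dvd \<beta>" using c p by (metis coprime_def not_prime_unit)
      then have "coprime \<beta> (p ^ k)"
        using p by (metis coprime_commute coprime_power_right_iff prime_imp_coprime)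
      then obtain u where u: "[\<beta> * u = 1] (mod p ^ k)" using cong_solve_coprime_int by blast
      then have cu: "coprime u (p ^ k)" by (metis coprime_iff_invertible_int mult.commute)
      obtain a where a: "\<alpha> = p * a" using True by blast
      define y where "y = u * a mod p ^ (k - 1)"
      have "p * y = u * \<alpha> mod p ^ k"
        by (simp only: y_def pk a mult_mod_right mult.left_commute[of u p])
      then have "M = congruence_sublattice e q (p ^ k) (p * y) 1"
        unfolding M using u cu
        by (intro congruence_sublattice_cong[symmetric, of u])
          (auto simp: mult.commute cong_sym)
      moreover have "y \<in> {0..<p ^ (k - 1)}" using pos by (simp add: y_def)
      ultimately show ?thesis by blast
    qed
  qed
  have "congruence_sublattice e q (p ^ k) \<alpha> \<beta> \<in> ?l" if "coprime \<alpha> \<beta>" for \<alpha> \<beta>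
    using that by blast
  then show "?A \<union> ?B \<subseteq> ?l"
    by (simp only: Un_subset_iff image_subset_iff coprime_1_left coprime_1_right ball_triv simp_thms)
qed

text \<open>The vectors \<open>(-x, 1)\<close> and \<open>(1, -p y)\<close> solve the congruences of \<open>(1, x)\<close> and \<open>(p y, 1)\<close>
  respectively. Substituting one solution into another normalised congruence shows that no two of
  them have the same solutions.\<close>

lemma card_congruence_sublattices_prime_power:
  assumes e: "lattice_basis L e" and q: "q > 0" and p: "prime p" and k: "k > 0"
  shows "card {congruence_sublattice e q (int p ^ k) \<alpha> \<beta> | \<alpha> \<beta>. coprime \<alpha> \<beta>} = p ^ k + p ^ (k - 1)"
proof -
  let ?C = "congruence_sublattice e q (int p ^ k)"
  have pos: "int p > 0" using p prime_gt_0_nat by simp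
  have pk: "int p ^ k = int p * int p ^ (k - 1)" using k by (simp add: power_eq_if)
  have transfer: "int p ^ k dvd \<alpha> * x + \<beta> * y \<longleftrightarrow> int p ^ k dvd \<alpha>' * x + \<beta>' * y"
    if "?C \<alpha> \<beta> = ?C \<alpha>' \<beta>'" for \<alpha> \<beta> \<alpha>' \<beta>' x y
    using mem_congruence_sublattice_iff[OF e, of q] q that by (metis less_irrefl)
  have small: "z = z'" if "n dvd z - z'" "z \<in> {0..<n}" "z' \<in> {0..<n}" for n z z' :: int
    using that by (metis atLeastLessThan_iff mod_eq_dvd_iff mod_pos_pos_trivial)
  have 1: "inj_on (\<lambda>x. ?C 1 x) {0..<int p ^ k}"
  proof (rule inj_onI)
    fix x x' assume x: "x \<in> {0..<int p ^ k}" "x' \<in> {0..<int p ^ k}" and "?C 1 x = ?C 1 x'"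
    from transfer[OF this(3), of "- x'" 1] have "int p ^ k dvd x - x'" by simp
    then show "x = x'" using small x by blast
  qed
  have 2: "inj_on (\<lambda>y. ?C (int p * y) 1) {0..<int p ^ (k - 1)}"
  proof (rule inj_onI)
    fix y y' assume y: "y \<in> {0..<int p ^ (k - 1)}" "y' \<in> {0..<int p ^ (k - 1)}"
      and "?C (int p * y) 1 = ?C (int p * y') 1"
    from transfer[OF this(3), of 1 "- (int p * y')"] have "int p ^ k dvd int p * (y - y')"
      by (simp add: algebra_simps)
    then have "int p ^ (k - 1) dvd y - y'" unfolding pk using pos by simp
    then show "y = y'" using small y by blast
  qed
  have 3: "?C 1 x \<noteq> ?C (int p * y) 1" for x y
  proof
    assume "?C 1 x = ?C (int p * y) 1"
    from transfer[OF this, of 1 "- (int p * y)"] have "int p ^ k dvd 1 - int p * (x * y)"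
      by (simp add: algebra_simps)
    then have "int p dvd 1 - int p * (x * y)" using k by (meson dvd_power dvd_trans)
    then have "int p dvd 1" by (metis dvd_diff_left_iff dvd_triv_left)
    then show False using p by (metis not_prime_unit prime_int_nat_transfer prime_nat_int_transfer)
  qed
  have "card {?C \<alpha> \<beta> | \<alpha> \<beta>. coprime \<alpha> \<beta>} =
      card ((\<lambda>x. ?C 1 x) ` {0..<int p ^ k}) + card ((\<lambda>y. ?C (int p * y) 1) ` {0..<int p ^ (k - 1)})"
    unfolding congruence_sublattice_normal_form[OF prime_nat_int_transfer[THEN iffD2, OF p] k]
    using 3 by (intro card_Un_disjoint) auto
  also have "\<dots> = p ^ k + p ^ (k - 1)"
    by (simp add: card_image[OF 1] card_image[OF 2, simplified] nat_power_eq)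
  finally show ?thesis .
qed

lemma S_class_eq_congruence_sublattices:
  assumes "lattice_basis L e" "p > 0" "a \<le> b"
  shows "S_class L p a b =
    {congruence_sublattice e (int p ^ a) (int p ^ (b - a)) \<alpha> \<beta> | \<alpha> \<beta>. coprime \<alpha> \<beta>}"
proof -
  have "int p ^ b = int p ^ a * int p ^ (b - a)"
    using assms(3) by (simp flip: power_add)
  then show ?thesis
    using invariant_factors_iff_congruence[OF assms(1), of "int p ^ a" "int p ^ (b - a)"] assms(2)
    by (auto simp: S_class_def)
qed

lemma S_class_same_exponents:
  assumes "lattice2 L" "p > 0"
  shows "\<exists>M. S_class L p a a = {M}"
proof -
  obtain e where "lattice_basis L e" using assms(1) by (auto simp: lattice2_def)
  then have "S_class L p a a = {congruence_sublattice e (int p ^ a) 1 \<alpha> \<beta> | \<alpha> \<beta>. coprime \<alpha> \<beta>}"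
    using S_class_eq_congruence_sublattices[of L e p a a] assms(2) by simp
  also have "\<dots> = {congruence_sublattice e (int p ^ a) 1 1 1}"
    by (auto simp: congruence_sublattice_def
        intro!: exI[of "\<lambda>\<alpha>. Ex (coprime \<alpha>)" 1] exI[of "coprime 1" 1])
  finally show ?thesis by blast
qed

theorem theorem3p1:
  fixes \<Lambda> :: "('a::euclidean_space) set" and p r t :: nat
  assumes "lattice2 \<Lambda>" and "prime p" and "r > 0" and "real t \<le> real r / 2"
  shows "f_class \<Lambda> p t (r - t) =
           (if real t < real r / 2 then p ^ (r - 2 * t) + p ^ (r - 2 * t - 1) else 1) \<and>
         (even r \<longrightarrow> (\<exists>M. S_class \<Lambda> p (r div 2) (r div 2) = {M}))"
proof -
  obtain e where e: "lattice_basis \<Lambda> e" using assms(1) by (auto simp: lattice2_def)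
  have p: "p > 0" using assms(2) prime_gt_0_nat by blast
  have "f_class \<Lambda> p t (r - t) = p ^ (r - 2 * t) + p ^ (r - 2 * t - 1)" if "real t < real r / 2"
  proof -
    have "r - t - t = r - 2 * t" "r - 2 * t > 0" "t \<le> r - t" using that by linarith+
    then show ?thesis
      using S_class_eq_congruence_sublattices[OF e p, of t "r - t"] p
        card_congruence_sublattices_prime_power[OF e _ assms(2), of "int p ^ t" "r - 2 * t"]
      by (simp add: f_class_def)
  qed
  moreover have "f_class \<Lambda> p t (r - t) = 1" if "\<not> real t < real r / 2"
  proof -
    have "r - t = t" using that assms(4) by linarith
    then show ?thesis
      using S_class_same_exponents[OF assms(1) p, of t] by (auto simp: f_class_def)
  qed
  ultimately show ?thesis using S_class_same_exponents[OF assms(1) p] by simp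
qed

end
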